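(* Let $H$ be a separable complex Hilbert space. Let $B\in B(H)$ be a bounded normal operator with a finite pure point spectrum, and let $A$ be a closed (possibly unbounded) linear operator in $H$ with domain $D(A)\subset H$. Let $f,g:\mathbb{C}\to\mathbb{C}$ be two continuous functions. Then $$BA\subset A f(B)\ \Longrightarrow\ g(B)A\subset A\,(g\circ f)(B).$$
   Context: $B(H)$ denotes the bounded everywhere-defined linear operators on $H$. For operators $S,T$ in $H$, $S\subset T$ means $D(S)\subset D(T)$ and $Sx=Tx$ for all $x\in D(S)$; products carry their natural domains, $D(ST)=\{x\in D(T): Tx\in D(S)\}$. "$B$ is normal with a finite pure point spectrum" means that $B$ has finitely many distinct eigenvalues $\lambda_1,\dots,\lambda_n$ whose orthogonal eigenprojectors $E_1,\dots,E_n$ add up to the identity, so that $B=\sum_{j=1}^n\lambda_jE_j$. For a function $h:\mathbb{C}\to\mathbb{C}$, $h(B)$ is given by the functional calculus, $h(B)=\sum_{j=1}^n h(\lambda_j)E_j$. *)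

theory Defs
  imports "HOL-Analysis.Analysis"
begin

section \<open>Complex Hilbert spaces\<close>

text \<open>The inner product is linear in its first argument. Positivity and definiteness follow from
  the last axiom together with the norm axioms.\<close>

class chilbert_space = banach +
  fixes scaleC :: "complex \<Rightarrow> 'a \<Rightarrow> 'a"  (infixr "*\<^sub>C" 75)
    and cinner :: "'a \<Rightarrow> 'a \<Rightarrow> complex"
  assumes scaleC_add_right: "a *\<^sub>C (x + y) = a *\<^sub>C x + a *\<^sub>C y"
    and scaleC_add_left: "(a + b) *\<^sub>C x = a *\<^sub>C x + b *\<^sub>C x"
    and scaleC_scaleC: "a *\<^sub>C (b *\<^sub>C x) = (a * b) *\<^sub>C x"
    and scaleR_scaleC: "scaleR r x = complex_of_real r *\<^sub>C x"
    and cinner_commute: "cinner x y = cnj (cinner y x)"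
    and cinner_add_left: "cinner (x + y) z = cinner x z + cinner y z"
    and cinner_scaleC_left: "cinner (a *\<^sub>C x) y = a * cinner x y"
    and cinner_self: "cinner x x = complex_of_real ((norm x)\<^sup>2)"

instantiation complex :: chilbert_space
begin
definition "scaleC a x = a * (x::complex)"
definition "cinner x y = (x::complex) * cnj y"
instance
proof
  fix x :: complex
  show "cinner x x = complex_of_real ((norm x)\<^sup>2)"
    unfolding cinner_complex_def by (rule complex_norm_square[symmetric])
qed (simp_all add: scaleC_complex_def cinner_complex_def distrib_left distrib_right mult_ac
      scaleR_conv_of_real)
end

definition csubspace :: "'a::chilbert_space set \<Rightarrow> bool" where
  "csubspace M \<longleftrightarrow> 0 \<in> M \<and> (\<forall>x\<in>M. \<forall>y\<in>M. x + y \<in> M) \<and> (\<forall>c. \<forall>x\<in>M. c *\<^sub>C x \<in> M)"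


section \<open>Possibly unbounded operators\<close>

text \<open>A possibly unbounded operator in \<open>H\<close> is a partial function \<open>A :: 'a \<rightharpoonup> 'a\<close> with domain
  \<^term>\<open>dom A\<close>. The product \<open>S T\<close> with its natural domain is \<open>S \<circ>\<^sub>m T\<close>, the inclusion of
  operators is \<open>S \<subseteq>\<^sub>m T\<close>, and an everywhere defined operator \<open>B\<close> becomes \<open>Some \<circ> B\<close>; the next two
  facts spell this out.\<close>

lemma dom_op_product:
  "dom (S \<circ>\<^sub>m T) = {x \<in> dom T. the (T x) \<in> dom S}"
proof (rule set_eqI)
  fix x show "x \<in> dom (S \<circ>\<^sub>m T) \<longleftrightarrow> x \<in> {x \<in> dom T. the (T x) \<in> dom S}"
    by (cases "T x") (simp_all add: map_comp_def domIff)
qed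

lemma op_inclusion_iff:
  "S \<subseteq>\<^sub>m T \<longleftrightarrow> dom S \<subseteq> dom T \<and> (\<forall>x\<in>dom S. the (S x) = the (T x))"
proof
  assume "S \<subseteq>\<^sub>m T"
  then show "dom S \<subseteq> dom T \<and> (\<forall>x\<in>dom S. the (S x) = the (T x))"
    by (simp add: map_le_implies_dom_le) (simp add: map_le_def)
next
  assume *: "dom S \<subseteq> dom T \<and> (\<forall>x\<in>dom S. the (S x) = the (T x))"
  show "S \<subseteq>\<^sub>m T"
    unfolding map_le_def
  proof
    fix x assume "x \<in> dom S"
    then have "x \<in> dom T" "the (S x) = the (T x)" using * by (blast, blast)
    with \<open>x \<in> dom S\<close> show "S x = T x" by (cases "S x"; cases "T x") (simp_all add: domIff)
  qed
qed

definition linear_operator :: "('a::chilbert_space \<rightharpoonup> 'a) \<Rightarrow> bool" where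
  "linear_operator A \<longleftrightarrow> csubspace (dom A) \<and>
     (\<forall>x\<in>dom A. \<forall>y\<in>dom A. the (A (x + y)) = the (A x) + the (A y)) \<and>
     (\<forall>c. \<forall>x\<in>dom A. the (A (c *\<^sub>C x)) = c *\<^sub>C the (A x))"

definition closed_operator :: "('a::chilbert_space \<rightharpoonup> 'a) \<Rightarrow> bool" where
  "closed_operator A \<longleftrightarrow> linear_operator A \<and> closed (Map.graph A)"


section \<open>Bounded normal operators\<close>

definition bounded_operator :: "('a::chilbert_space \<Rightarrow> 'a) \<Rightarrow> bool" where
  "bounded_operator B \<longleftrightarrow> bounded_linear B \<and> (\<forall>c x. B (c *\<^sub>C x) = c *\<^sub>C B x)"

definition is_adjoint :: "('a::chilbert_space \<Rightarrow> 'a) \<Rightarrow> ('a \<Rightarrow> 'a) \<Rightarrow> bool" where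
  "is_adjoint B C \<longleftrightarrow> (\<forall>x y. cinner (B x) y = cinner x (C y))"

text \<open>Normality: \<open>B\<close> commutes with its adjoint (which is unique).\<close>

definition normal_operator :: "('a::chilbert_space \<Rightarrow> 'a) \<Rightarrow> bool" where
  "normal_operator B \<longleftrightarrow> bounded_operator B \<and>
     (\<exists>C. bounded_operator C \<and> is_adjoint B C \<and> B \<circ> C = C \<circ> B)"


section \<open>Orthogonal projections, finite pure point spectrum, functional calculus\<close>

text \<open>Meaningful for closed subspaces \<open>M\<close>; see \<open>orth_proj_exists_unique\<close> below.\<close>

definition orth_proj :: "'a::chilbert_space set \<Rightarrow> 'a \<Rightarrow> 'a" where
  "orth_proj M x = (THE y. y \<in> M \<and> (\<forall>z\<in>M. cinner (x - y) z = 0))"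

definition eigenvalues :: "('a::chilbert_space \<Rightarrow> 'a) \<Rightarrow> complex set" where
  "eigenvalues B = {l. \<exists>x. x \<noteq> 0 \<and> B x = l *\<^sub>C x}"

definition eigenspace :: "('a::chilbert_space \<Rightarrow> 'a) \<Rightarrow> complex \<Rightarrow> 'a set" where
  "eigenspace B l = {x. B x = l *\<^sub>C x}"

definition eigenprojector :: "('a::chilbert_space \<Rightarrow> 'a) \<Rightarrow> complex \<Rightarrow> 'a \<Rightarrow> 'a" where
  "eigenprojector B l = orth_proj (eigenspace B l)"

definition finite_pure_point_spectrum :: "('a::chilbert_space \<Rightarrow> 'a) \<Rightarrow> bool" where
  "finite_pure_point_spectrum B \<longleftrightarrow> finite (eigenvalues B) \<and>
     (\<forall>x. (\<Sum>l\<in>eigenvalues B. eigenprojector B l x) = x)"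

text \<open>The functional calculus \<open>h(B)\<close>, for \<open>B\<close> normal with a finite pure point spectrum.\<close>

definition fun_calc :: "(complex \<Rightarrow> complex) \<Rightarrow> ('a::chilbert_space \<Rightarrow> 'a) \<Rightarrow> 'a \<Rightarrow> 'a" where
  "fun_calc h B x = (\<Sum>l\<in>eigenvalues B. h l *\<^sub>C eigenprojector B l x)"


section \<open>Well-definedness of the eigenprojectors\<close>

lemma scaleC_minus_one: "(-1) *\<^sub>C x = - (x::'a::chilbert_space)"
  using scaleR_scaleC[of "-1" x] by simp

lemma scaleC_zero_right: "c *\<^sub>C 0 = (0::'a::chilbert_space)"
  using scaleC_add_right[of c 0 0] by (metis add_0_left add_left_cancel add_0_right)

lemma csubspace_diff:
  "\<lbrakk>csubspace M; x \<in> M; y \<in> M\<rbrakk> \<Longrightarrow> x - y \<in> (M::'a::chilbert_space set)"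
proof -
  assume M: "csubspace M" "x \<in> M" "y \<in> M"
  then have "(-1) *\<^sub>C y \<in> M" unfolding csubspace_def by blast
  then have "x + (-1) *\<^sub>C y \<in> M" using M unfolding csubspace_def by blast
  then show ?thesis by (simp add: scaleC_minus_one)
qed

lemma cinner_add_right: "cinner x (y + z) = cinner x y + cinner (x::'a::chilbert_space) z"
  unfolding cinner_commute[of x] by (simp add: cinner_add_left)

lemma cinner_scaleC_right: "cinner x (c *\<^sub>C y) = cnj c * cinner (x::'a::chilbert_space) y"
  unfolding cinner_commute[of x] by (simp add: cinner_scaleC_left)

lemma cinner_minus_left: "cinner (- x) y = - cinner (x::'a::chilbert_space) y"
  using cinner_scaleC_left[of "-1" x y] by (simp add: scaleC_minus_one)

lemma cinner_minus_right: "cinner x (- y) = - cinner (x::'a::chilbert_space) y"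
  using cinner_scaleC_right[of x "-1" y] by (simp add: scaleC_minus_one)

lemma cinner_diff_left: "cinner (x - y) z = cinner x z - cinner (y::'a::chilbert_space) z"
  using cinner_add_left[of x "- y" z] by (simp add: cinner_minus_left)

lemma mult_cnj_norm: "c * cnj c = (complex_of_real (norm c))\<^sup>2"
  using complex_norm_square[of c] by simp

lemma norm_add_sq:
  "(norm (x + y))\<^sup>2 = (norm x)\<^sup>2 + 2 * Re (cinner x y) + (norm (y::'a::chilbert_space))\<^sup>2"
proof -
  have "Re (cinner (x + y) (x + y))
      = Re (cinner x x) + Re (cinner x y) + Re (cinner y x) + Re (cinner y y)"
    by (simp add: cinner_add_left cinner_add_right)
  moreover have "Re (cinner y x) = Re (cinner x y)"
    by (subst cinner_commute) simp
  ultimately show ?thesis by (simp add: cinner_self)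
qed

lemma norm_diff_sq:
  "(norm (x - y))\<^sup>2 = (norm x)\<^sup>2 - 2 * Re (cinner x y) + (norm (y::'a::chilbert_space))\<^sup>2"
  using norm_add_sq[of x "- y"] by (simp add: cinner_minus_right)

lemma parallelogram_law:
  "(norm (x + y))\<^sup>2 + (norm (x - y))\<^sup>2 = 2 * (norm x)\<^sup>2 + 2 * (norm (y::'a::chilbert_space))\<^sup>2"
  by (simp add: norm_add_sq norm_diff_sq)

lemma closest_imp_orthogonal:
  fixes x :: "'a::chilbert_space"
  assumes M: "csubspace M" "y \<in> M" "z \<in> M"
    and min: "\<And>w. w \<in> M \<Longrightarrow> norm (x - y) \<le> norm (x - w)"
  shows "cinner (x - y) z = 0"
proof (rule ccontr)
  define c where "c = cinner (x - y) z"
  assume "cinner (x - y) z \<noteq> 0"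
  then have c0: "c \<noteq> 0" and z0: "z \<noteq> 0"
    using cinner_scaleC_right[of "x - y" 0 z] scaleR_scaleC[of 0 z] by (auto simp: c_def)
  define t where "t = c / complex_of_real ((norm z)\<^sup>2)"
  have "y + t *\<^sub>C z \<in> M" using M by (simp add: csubspace_def)
  then have "(norm (x - y))\<^sup>2 \<le> (norm ((x - y) - t *\<^sub>C z))\<^sup>2"
    using min by (simp add: power_mono diff_diff_eq)
  moreover have "cinner (x - y) (t *\<^sub>C z) = complex_of_real ((norm c)\<^sup>2 / (norm z)\<^sup>2)"
    by (simp add: cinner_scaleC_right flip: c_def) (simp add: t_def mult_cnj_norm mult.commute)
  moreover have "(norm (t *\<^sub>C z))\<^sup>2 = (norm c)\<^sup>2 / (norm z)\<^sup>2"
  proof -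
    have "complex_of_real ((norm (t *\<^sub>C z))\<^sup>2) = t * cnj t * complex_of_real ((norm z)\<^sup>2)"
      by (simp only: cinner_scaleC_right cinner_scaleC_left mult_ac flip: cinner_self)
    also have "\<dots> = complex_of_real ((norm c)\<^sup>2 / (norm z)\<^sup>2)"
      using z0 mult_cnj_norm[of c] by (simp add: t_def field_simps power2_eq_square)
    finally show ?thesis using of_real_eq_iff by blast
  qed
  ultimately have "(norm c)\<^sup>2 / (norm z)\<^sup>2 \<le> 0"
    by (simp add: norm_diff_sq[of "x - y" "t *\<^sub>C z"])
  moreover have "0 < (norm c)\<^sup>2 / (norm z)\<^sup>2" using c0 z0 by simp
  ultimately show False by linarith
qed

lemma closest_exists:
  fixes x :: "'a::chilbert_space"
  assumes M: "csubspace M" "closed M"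
  obtains y where "y \<in> M" "\<And>w. w \<in> M \<Longrightarrow> norm (x - y) \<le> norm (x - w)"
proof -
  define d where "d = (INF w\<in>M. norm (x - w))"
  have ne: "M \<noteq> {}" using M by (auto simp: csubspace_def)
  have bdd: "bdd_below ((\<lambda>w. norm (x - w)) ` M)" by (rule bdd_belowI[of _ 0]) auto
  have d_le: "d \<le> norm (x - w)" if "w \<in> M" for w
    unfolding d_def using bdd that by (rule cINF_lower)
  have d0: "0 \<le> d" unfolding d_def using ne by (intro cINF_greatest) auto
  have "\<exists>w\<in>M. norm (x - w) < d + inverse (real (Suc n))" for n
    using cINF_less_iff[OF ne bdd, of "d + inverse (real (Suc n))"] by (simp add: d_def)
  then obtain s where sM: "\<And>n. s n \<in> M"
    and s: "\<And>n. norm (x - s n) < d + inverse (real (Suc n))" by metis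
  have lim: "(\<lambda>n. norm (x - s n)) \<longlonglongrightarrow> d"
  proof (rule tendsto_sandwich[of "\<lambda>_. d"])
    show "(\<lambda>n. d + inverse (real (Suc n))) \<longlonglongrightarrow> d"
      using tendsto_add[OF tendsto_const LIMSEQ_inverse_real_of_nat, of d] by simp
  qed (use d_le sM s in \<open>auto intro!: always_eventually less_imp_le simp del: of_nat_Suc\<close>)
  have est: "(norm (s m - s n))\<^sup>2 \<le> 2 * ((norm (x - s m))\<^sup>2 - d\<^sup>2) + 2 * ((norm (x - s n))\<^sup>2 - d\<^sup>2)"
    for m n
  proof -
    define w where "w = (1/2) *\<^sub>R (s m + s n)"
    have "w \<in> M" using M(1) sM by (simp add: w_def scaleR_scaleC csubspace_def)
    have "(x - s m) + (x - s n) = 2 *\<^sub>R (x - w)"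
      by (simp add: w_def scaleR_diff_right scaleR_2)
    then have "(norm ((x - s m) + (x - s n)))\<^sup>2 = 4 * (norm (x - w))\<^sup>2"
      by (simp add: power_mult_distrib)
    moreover have "d\<^sup>2 \<le> (norm (x - w))\<^sup>2"
      using d_le[OF \<open>w \<in> M\<close>] d0 by (simp add: power_mono)
    moreover have "norm ((x - s m) - (x - s n)) = norm (s m - s n)"
      by (simp add: norm_minus_commute)
    ultimately show ?thesis
      using parallelogram_law[of "x - s m" "x - s n"] by simp
  qed
  have "Cauchy s"
  proof (rule metric_CauchyI)
    fix e :: real assume e: "0 < e"
    have "(\<lambda>n. (norm (x - s n))\<^sup>2 - d\<^sup>2) \<longlonglongrightarrow> d\<^sup>2 - d\<^sup>2" by (intro tendsto_intros lim)
    then have "\<forall>\<^sub>F n in sequentially. (norm (x - s n))\<^sup>2 - d\<^sup>2 < e\<^sup>2 / 4"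
      using e by (intro order_tendstoD(2)[where y = 0]) auto
    then obtain N where N: "\<And>n. n \<ge> N \<Longrightarrow> (norm (x - s n))\<^sup>2 - d\<^sup>2 < e\<^sup>2 / 4"
      by (auto simp: eventually_sequentially)
    have "dist (s m) (s n) < e" if "m \<ge> N" "n \<ge> N" for m n
    proof -
      have "(norm (s m - s n))\<^sup>2 < e\<^sup>2" 
        using est[of m n] N[OF that(1)] N[OF that(2)] by (simp add: field_simps)
      then show ?thesis using e by (simp add: dist_norm power_less_imp_less_base)
    qed
    then show "\<exists>N. \<forall>m\<ge>N. \<forall>n\<ge>N. dist (s m) (s n) < e" by blast
  qed
  then obtain y where y: "s \<longlonglongrightarrow> y" using Cauchy_convergent convergent_def by blast
  have "y \<in> M" using M(2) sM y closed_sequentially by blast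
  moreover have "norm (x - y) = d"
    by (rule LIMSEQ_unique[OF _ lim]) (intro tendsto_intros y)
  ultimately show thesis using that d_le by blast
qed

lemma orth_proj_exists_unique:
  fixes x :: "'a::chilbert_space"
  assumes "csubspace M" "closed M"
  shows "\<exists>!y. y \<in> M \<and> (\<forall>z\<in>M. cinner (x - y) z = 0)"
proof -
  obtain y where y: "y \<in> M" "\<forall>z\<in>M. cinner (x - y) z = 0"
    using closest_exists[OF assms] closest_imp_orthogonal[OF assms(1)] by metis
  moreover have "y' = y" if y': "y' \<in> M" "\<forall>z\<in>M. cinner (x - y') z = 0" for y'
  proof -
    have "y - y' \<in> M" using assms(1) y(1) y'(1) by (rule csubspace_diff)
    then have "cinner ((x - y') - (x - y)) (y - y') = 0"
      using y y' by (simp only: cinner_diff_left[of "x - y'" "x - y"]) simp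
    then show ?thesis by (simp add: cinner_self)
  qed
  ultimately show ?thesis by blast
qed

lemma eigenspace_closed_csubspace:
  assumes "bounded_operator B"
  shows "csubspace (eigenspace B l)" "closed (eigenspace B l)"
proof -
  have B: "bounded_linear B" "\<And>c x. B (c *\<^sub>C x) = c *\<^sub>C B x"
    using assms by (auto simp: bounded_operator_def)
  interpret bounded_linear B by (rule B)
  show "csubspace (eigenspace B l)"
    by (auto simp: csubspace_def eigenspace_def scaleC_zero_right zero add scaleC_add_right B(2)
        scaleC_scaleC mult.commute)
  have norm_scaleC: "norm (c *\<^sub>C x) = norm c * norm x" for c and x :: 'a
  proof -
    have "complex_of_real ((norm (c *\<^sub>C x))\<^sup>2) = c * cnj c * complex_of_real ((norm x)\<^sup>2)"
      by (simp only: cinner_scaleC_right cinner_scaleC_left mult_ac flip: cinner_self)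
    also have "\<dots> = complex_of_real ((norm c * norm x)\<^sup>2)"
      by (simp add: power_mult_distrib mult_cnj_norm)
    finally have "(norm (c *\<^sub>C x))\<^sup>2 = (norm c * norm x)\<^sup>2" using of_real_eq_iff by blast
    then show ?thesis by (simp add: power2_eq_iff_nonneg)
  qed
  have "bounded_linear (\<lambda>x::'a. l *\<^sub>C x)"
    by (rule bounded_linear_intro[of _ "norm l"])
      (simp_all add: scaleC_add_right scaleR_scaleC scaleC_scaleC norm_scaleC mult.commute)
  then show "closed (eigenspace B l)"
    unfolding eigenspace_def
    by (intro closed_Collect_eq linear_continuous_on B(1))
qed

end

theory Submission
  imports Defs
begin

text \<open>
  Why the theorem holds. The hypothesis says that \<open>A\<close> intertwines \<open>f(B)\<close> with \<open>B\<close>: if \<open>x\<close> is in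
  the domain of \<open>A\<close>, so is \<open>f(B) x\<close>, and \<open>A f(B) x = B A x\<close>. Since the vector \<open>f(B) x\<close> is again
  in the domain, this can be iterated, and by linearity of \<open>A\<close> it follows that
  \<open>A p(f(B)) x = p(B) A x\<close> for every polynomial \<open>p\<close> (\<open>intertwining_polynomial\<close>).

  An operator \<open>h(B)\<close> depends only on the values of \<open>h\<close> at the eigenvalues of \<open>B\<close>. These are finite
  in number, and so are their images under \<open>f\<close>, so some polynomial \<open>p\<close> coincides with \<open>g\<close>
  on both finite sets (\<open>interpolating_polynomial\<close>). For this \<open>p\<close> the operators \<open>p(B)\<close> and
  \<open>p(f(B)) = (p \<circ> f)(B)\<close> are \<open>g(B)\<close> and \<open>(g \<circ> f)(B)\<close>.

  Reading \<open>p(f(B))\<close> as \<open>(p \<circ> f)(B)\<close> requires that the functional calculus be multiplicative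
  (\<open>fun_calc_mult\<close>). This, too, comes from interpolation: \<open>B h(B) = (z h)(B)\<close> holds because
  the eigenprojectors map into eigenspaces, iteration gives \<open>q(B) h(B) = (q h)(B)\<close> for
  polynomials \<open>q\<close>, and on the spectrum every function is a polynomial.
\<close>

section \<open>Linear algebra in a complex Hilbert space\<close>

lemma scaleC_one: "1 *\<^sub>C x = (x::'a::chilbert_space)"
  using scaleR_scaleC[of 1 x] by simp

lemma scaleC_zero_left: "0 *\<^sub>C x = (0::'a::chilbert_space)"
  using scaleR_scaleC[of 0 x] by simp

lemma scaleC_sum_right: "c *\<^sub>C (\<Sum>i\<in>I. u i) = (\<Sum>i\<in>I. c *\<^sub>C (u i :: 'a::chilbert_space))"
  by (induction I rule: infinite_finite_induct) (simp_all add: scaleC_zero_right scaleC_add_right)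

lemma linear_operator_zero:
  assumes "linear_operator A"
  shows "A 0 = Some 0"
proof -
  have "0 \<in> dom A" and "the (A (0 *\<^sub>C 0)) = 0 *\<^sub>C the (A 0)"
    using assms by (auto simp: linear_operator_def csubspace_def)
  then show ?thesis by (auto simp: scaleC_zero_left)
qed

lemma linear_operator_add:
  assumes "linear_operator A" "A u = Some u'" "A v = Some v'"
  shows "A (u + v) = Some (u' + v')"
proof -
  have uv: "u \<in> dom A" "v \<in> dom A" using assms(2,3) by auto
  then have "u + v \<in> dom A" "the (A (u + v)) = the (A u) + the (A v)"
    using assms(1) unfolding linear_operator_def csubspace_def by blast+
  then show ?thesis using assms(2,3) by auto
qed

lemma linear_operator_scaleC:
  assumes "linear_operator A" "A u = Some u'"
  shows "A (c *\<^sub>C u) = Some (c *\<^sub>C u')"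
proof -
  have "u \<in> dom A" using assms(2) by auto
  then have "c *\<^sub>C u \<in> dom A" "the (A (c *\<^sub>C u)) = c *\<^sub>C the (A u)"
    using assms(1) unfolding linear_operator_def csubspace_def by blast+
  then show ?thesis using assms(2) by auto
qed

section \<open>Interpolation\<close>

text \<open>Newton's step: adding a multiple of \<open>\<Prod>b\<in>F. (z - b)\<close> leaves the values on \<open>F\<close> unchanged
  and adjusts the value at the new point.\<close>

lemma interpolating_polynomial:
  fixes h :: "'a::field \<Rightarrow> 'a"
  assumes "finite F"
  shows "\<exists>p. \<forall>z\<in>F. poly p z = h z"
  using assms
proof (induction F)
  case empty
  show ?case by simp
next
  case (insert a F)
  then obtain p where p: "\<forall>z\<in>F. poly p z = h z" by blast
  define w where "w = (\<Prod>b\<in>F. [:- b, 1:])"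
  have w: "poly w z = (\<Prod>b\<in>F. z - b)" for z by (simp add: w_def poly_prod)
  have "poly w a \<noteq> 0" using insert.hyps by (auto simp: w)
  moreover have "\<forall>z\<in>F. poly w z = 0" using insert.hyps by (auto simp: w)
  ultimately have "\<forall>z\<in>insert a F. poly (p + smult ((h a - poly p a) / poly w a) w) z = h z"
    using p by simp
  then show ?case by blast
qed

section \<open>The functional calculus\<close>

lemma fun_calc_cong:
  "(\<And>l. l \<in> eigenvalues B \<Longrightarrow> h l = k l) \<Longrightarrow> fun_calc h B = fun_calc k B"
  by (auto simp: fun_calc_def fun_eq_iff intro: sum.cong)

lemma fun_calc_add:
  "fun_calc (\<lambda>l. h l + k l) B x = fun_calc h B x + fun_calc k B x"
  by (simp add: fun_calc_def scaleC_add_left sum.distrib)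

lemma fun_calc_scaleC:
  "fun_calc (\<lambda>l. c * h l) B x = c *\<^sub>C fun_calc h B x"
  by (simp add: fun_calc_def scaleC_sum_right scaleC_scaleC)

lemma fun_calc_zero: "fun_calc (\<lambda>_. 0) B x = 0"
  by (simp add: fun_calc_def scaleC_zero_left)

text \<open>That the eigenprojectors add up to the identity is the unit law of the calculus.\<close>

lemma fun_calc_const:
  assumes "finite_pure_point_spectrum B"
  shows "fun_calc (\<lambda>_. c) B x = c *\<^sub>C x"
  using assms by (simp add: fun_calc_def finite_pure_point_spectrum_def flip: scaleC_sum_right)

lemma eigenprojector_eigenvector:
  assumes "bounded_operator B"
  shows "B (eigenprojector B l x) = l *\<^sub>C eigenprojector B l x"
proof -
  have "eigenprojector B l x \<in> eigenspace B l"
    unfolding eigenprojector_def orth_proj_def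
    using theI'[OF orth_proj_exists_unique[OF eigenspace_closed_csubspace[OF assms]]] by blast
  then show ?thesis by (simp add: eigenspace_def)
qed

lemma fun_calc_mult_id:
  assumes "bounded_operator B"
  shows "fun_calc (\<lambda>l. l * h l) B x = B (fun_calc h B x)"
proof -
  interpret bounded_linear B using assms by (simp add: bounded_operator_def)
  have "B (h l *\<^sub>C eigenprojector B l x) = (l * h l) *\<^sub>C eigenprojector B l x" for l
    using assms eigenprojector_eigenvector[OF assms, of l x]
    by (simp add: bounded_operator_def scaleC_scaleC mult.commute)
  then show ?thesis by (simp add: fun_calc_def sum)
qed

lemma fun_calc_poly_mult:
  assumes "bounded_operator B" "finite_pure_point_spectrum B"
  shows "fun_calc (\<lambda>l. poly q l * h l) B x = fun_calc (poly q) B (fun_calc h B x)"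
proof (induction q)
  case 0
  show ?case by (simp add: fun_calc_zero)
next
  case (pCons a q)
  have "fun_calc (\<lambda>l. poly (pCons a q) l * h l) B x
      = fun_calc (\<lambda>l. a * h l + l * (poly q l * h l)) B x"
    by (simp add: algebra_simps)
  also have "\<dots> = a *\<^sub>C fun_calc h B x + B (fun_calc (poly q) B (fun_calc h B x))"
    by (simp add: fun_calc_add fun_calc_scaleC fun_calc_mult_id[OF assms(1)] pCons.IH)
  also have "\<dots> = fun_calc (\<lambda>l. a + l * poly q l) B (fun_calc h B x)"
    by (simp add: fun_calc_add fun_calc_const[OF assms(2)] fun_calc_mult_id[OF assms(1)])
  finally show ?case by simp
qed

text \<open>The usual argument is that eigenprojectors to distinct eigenvalues annihilate each other.
  It is enough to know that the first factor agrees with a polynomial on the eigenvalues, since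
  for polynomials only \<open>B h(B) = (z h)(B)\<close> is involved.\<close>

lemma fun_calc_mult:
  assumes "bounded_operator B" "finite_pure_point_spectrum B"
  shows "fun_calc (\<lambda>l. k l * h l) B x = fun_calc k B (fun_calc h B x)"
proof -
  have "finite (eigenvalues B)" using assms(2) by (simp add: finite_pure_point_spectrum_def)
  then obtain q where q: "\<forall>l\<in>eigenvalues B. poly q l = k l"
    using interpolating_polynomial[where h = k] by blast
  have "fun_calc (\<lambda>l. k l * h l) B = fun_calc (\<lambda>l. poly q l * h l) B"
    and "fun_calc k B = fun_calc (poly q) B"
    by (rule fun_calc_cong, simp add: q)+
  then show ?thesis by (simp add: fun_calc_poly_mult[OF assms])
qed

section \<open>Intertwining\<close>

text \<open>Pointwise form of \<open>S A \<subset> A T\<close> for everywhere defined \<open>S\<close> and \<open>T\<close>; membership in the domain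
  is part of the equation \<open>A (T u) = Some (S v)\<close>.\<close>

lemma intertwining_iff:
  "(Some \<circ> S) \<circ>\<^sub>m A \<subseteq>\<^sub>m A \<circ>\<^sub>m (Some \<circ> T) \<longleftrightarrow> (\<forall>u v. A u = Some v \<longrightarrow> A (T u) = Some (S v))"
  by (force simp: map_le_def map_comp_def dom_def split: option.splits)

text \<open>In Horner's scheme, \<open>p(f(B)) x = a x + f(B) (q(f(B)) x)\<close> when \<open>p = a + z q\<close>. By induction
  \<open>q(f(B)) x\<close> lies in the domain of \<open>A\<close>, so the hypothesis applies to it.\<close>

lemma intertwining_polynomial:
  assumes B: "bounded_operator B" "finite_pure_point_spectrum B"
    and A: "linear_operator A"
    and AB: "\<And>u v. A u = Some v \<Longrightarrow> A (fun_calc f B u) = Some (B v)"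
    and x: "A x = Some y"
  shows "A (fun_calc (\<lambda>l. poly p (f l)) B x) = Some (fun_calc (poly p) B y)"
proof (induction p)
  case 0
  show ?case by (simp add: fun_calc_zero linear_operator_zero[OF A])
next
  case (pCons a q)
  have "fun_calc (\<lambda>l. poly (pCons a q) (f l)) B x
      = a *\<^sub>C x + fun_calc f B (fun_calc (\<lambda>l. poly q (f l)) B x)"
    by (simp add: fun_calc_add fun_calc_const[OF B(2)] fun_calc_mult[OF B])
  moreover have "fun_calc (poly (pCons a q)) B y = a *\<^sub>C y + B (fun_calc (poly q) B y)"
    using fun_calc_add[of "\<lambda>_. a" "\<lambda>l. l * poly q l" B y]
    by (simp add: fun_calc_const[OF B(2)] fun_calc_mult_id[OF B(1)] poly_pCons[abs_def])
  moreover have "A (a *\<^sub>C x + fun_calc f B (fun_calc (\<lambda>l. poly q (f l)) B x))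
      = Some (a *\<^sub>C y + B (fun_calc (poly q) B y))"
    by (intro linear_operator_add[OF A] linear_operator_scaleC[OF A x] AB[OF pCons.IH])
  ultimately show ?case by (simp only:)
qed

theorem theorem2p1:
  fixes B :: "'a::chilbert_space \<Rightarrow> 'a"
    and A :: "'a \<rightharpoonup> 'a"
    and f g :: "complex \<Rightarrow> complex"
  assumes "separable_space (euclidean :: 'a topology)"
    and "bounded_operator B" and "normal_operator B" and "finite_pure_point_spectrum B"
    and "closed_operator A"
    and "continuous_on UNIV f" and "continuous_on UNIV g"
    and "(Some \<circ> B) \<circ>\<^sub>m A \<subseteq>\<^sub>m A \<circ>\<^sub>m (Some \<circ> fun_calc f B)"
  shows "(Some \<circ> fun_calc g B) \<circ>\<^sub>m A \<subseteq>\<^sub>m A \<circ>\<^sub>m (Some \<circ> fun_calc (g \<circ> f) B)"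
proof -
  have A: "linear_operator A" using assms(5) by (simp add: closed_operator_def)
  have AB: "A (fun_calc f B u) = Some (B v)" if "A u = Some v" for u v
    using assms(8) that unfolding intertwining_iff by blast
  have "finite (eigenvalues B \<union> f ` eigenvalues B)"
    using assms(4) by (simp add: finite_pure_point_spectrum_def)
  then obtain p where p: "\<forall>z\<in>eigenvalues B \<union> f ` eigenvalues B. poly p z = g z"
    using interpolating_polynomial[where h = g] by blast
  have "fun_calc (poly p) B = fun_calc g B"
    and "fun_calc (\<lambda>l. poly p (f l)) B = fun_calc (g \<circ> f) B"
    by (rule fun_calc_cong, simp add: p)+
  then show ?thesis
    unfolding intertwining_iff
    using intertwining_polynomial[OF assms(2,4) A AB, where p = p] by simp
qed

end
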